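(* Let $(c,c_F)$ be a null congruence in Lorentz space $\mathbf{L}^3$, and let $(p,p_F)$ be the circle pattern given by $$p(v)=c(v)\cap\mathbf{E}^2\quad (v\in\mathbb{Z}^2),\qquad p_F(f)=c_F(f)\cap\mathbf{E}^2\quad (f\in F(\mathbb{Z}^2)).$$ Then $p$ is a circle packing, i.e. for any two black vertices $b,b'$ incident with a common face of $\mathbb{Z}^2$ the circles $p(b)$ and $p(b')$ touch.
   Context: $\mathbb{Z}^2$ denotes the vertex set of the square lattice graph and $F(\mathbb{Z}^2)$ its set of unit square faces. Black vertices are those $z$ with $z_1+z_2$ even, white vertices those with $z_1+z_2$ odd. Each face is incident with two black and two white vertices. Lorentz space $\mathbf{L}^3$ is $\mathbb{R}^3$ with $\langle x,y\rangle = x_1y_1+x_2y_2-x_3y_3$; the Euclidean plane is $\mathbf{E}^2=\{x\in\mathbf{L}^3:x_3=0\}$. Circles in $\mathbf{E}^2$ are ordinary Euclidean circles, radius $0$ allowed. Two circles with centers $a,a'$ and radii $\rho,\rho'\ge 0$ touch if $|a-a'|=\rho+\rho'$ or $|a-a'|=|\rho-\rho'|$ (outer or inner tangency, degenerate cases included). Oriented spheres: an oriented timelike sphere has center $m\in\mathbf{L}^3$ and signed radius $r\ne0$; its point set is $\{x:\langle x-m,x-m\rangle=r^2\}$ (outward oriented if $r>0$, inward if $r<0$). A null-sphere with center $m$ is $\{x:\langle x-m,x-m\rangle=0\}$. An isotropic line is $L=\{q+td\}$ with $d\ne0$, $\langle d,d\rangle=0$; it lies in the unique isotropic plane $H_L=\{x:\langle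 x-q,d\rangle=0\}$. An orientation of $L$ is the choice of a component $\Omega$ of $H_L\setminus L$. A null-sphere is in contact with $(L,\Omega)$ iff its center lies on $L$. An oriented timelike sphere $(m,r)$ is in contact with $(L,\Omega)$ iff it contains $L$ (forcing $m\in H_L\setminus L$) and $m\notin\Omega$ if $r>0$, $m\in\Omega$ if $r<0$. A contact congruence is a pair of maps $c$ (from $\mathbb{Z}^2$ to oriented timelike spheres and null-spheres) and $c_F$ (from $F(\mathbb{Z}^2)$ to oriented isotropic lines) with $c(v)$ in oriented contact with $c_F(f)$ whenever $v$ and $f$ are incident. A null congruence is a contact congruence such that $c(b)$ is a null-sphere for each black vertex $b$ and $c(w)$ is an oriented timelike sphere for each white vertex $w$. A circle pattern is a pair $p$ (from $\mathbb{Z}^2$ to circles in $\mathbf{E}^2$), $p_F:F(\mathbb{Z}^2)\to\mathbf{E}^2$ with $p_F(f)\in p(v)$ whenever $v,f$ are incident. A circle packing is a circle pattern such that for any two black vertices $b,b'$ incident with a common face the circles $p(b)$, $p(b')$ touch. *)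

theory Defs
  imports "HOL-Analysis.Analysis"
begin

type_synonym vertex = "int \<times> int"

text \<open>A unit square face is named by its lower left corner.\<close>

type_synonym face = "int \<times> int"

definition incident :: "vertex \<Rightarrow> face \<Rightarrow> bool" where
  "incident v f \<longleftrightarrow> v \<in> {fst f, fst f + 1} \<times> {snd f, snd f + 1}"

definition black :: "vertex \<Rightarrow> bool" where
  "black v \<longleftrightarrow> even (fst v + snd v)"

definition white :: "vertex \<Rightarrow> bool" where
  "white v \<longleftrightarrow> odd (fst v + snd v)"

definition lorentz :: "real^3 \<Rightarrow> real^3 \<Rightarrow> real" where
  "lorentz x y = x $ 1 * y $ 1 + x $ 2 * y $ 2 - x $ 3 * y $ 3"

definition E2 :: "(real^3) set" where
  "E2 = {x. x $ 3 = 0}"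

text \<open>
  The arguments of \<open>Timelike\<close> are the center and the signed radius. The radius has to be nonzero,
  which the datatype does not enforce; \<open>lorentz_sphere\<close> does.
\<close>

datatype lsphere = Timelike "real^3" real | Null "real^3"

fun lorentz_sphere :: "lsphere \<Rightarrow> bool" where
  "lorentz_sphere (Timelike m r) \<longleftrightarrow> r \<noteq> 0"
| "lorentz_sphere (Null m) \<longleftrightarrow> True"

fun sphere_points :: "lsphere \<Rightarrow> (real^3) set" where
  "sphere_points (Timelike m r) = {x. lorentz (x - m) (x - m) = r\<^sup>2}"
| "sphere_points (Null m) = {x. lorentz (x - m) (x - m) = 0}"

text \<open>
  An oriented line is a pair \<open>(L, \<Omega>)\<close>. The set \<open>{x. lorentz (x - q) d = 0}\<close> is the isotropic
  plane \<open>H\<^sub>L\<close>; it does not depend on the choice of \<open>q\<close> and \<open>d\<close>.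
\<close>

type_synonym oline = "(real^3) set \<times> (real^3) set"

definition oriented_isotropic_line :: "oline \<Rightarrow> bool" where
  "oriented_isotropic_line l \<longleftrightarrow>
    (\<exists>q d. d \<noteq> 0 \<and> lorentz d d = 0 \<and>
       fst l = {q + t *\<^sub>R d | t. True} \<and>
       snd l \<in> components ({x. lorentz (x - q) d = 0} - fst l))"

fun in_contact :: "lsphere \<Rightarrow> oline \<Rightarrow> bool" where
  "in_contact (Timelike m r) (L, \<Omega>) \<longleftrightarrow>
     L \<subseteq> sphere_points (Timelike m r) \<and> (r > 0 \<longrightarrow> m \<notin> \<Omega>) \<and> (r < 0 \<longrightarrow> m \<in> \<Omega>)"
| "in_contact (Null m) (L, \<Omega>) \<longleftrightarrow> m \<in> L"

definition contact_congruence :: "(vertex \<Rightarrow> lsphere) \<Rightarrow> (face \<Rightarrow> oline) \<Rightarrow> bool" where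
  "contact_congruence c cF \<longleftrightarrow>
     (\<forall>v. lorentz_sphere (c v)) \<and> (\<forall>f. oriented_isotropic_line (cF f)) \<and>
     (\<forall>v f. incident v f \<longrightarrow> in_contact (c v) (cF f))"

definition null_congruence :: "(vertex \<Rightarrow> lsphere) \<Rightarrow> (face \<Rightarrow> oline) \<Rightarrow> bool" where
  "null_congruence c cF \<longleftrightarrow>
     contact_congruence c cF \<and>
     (\<forall>b. black b \<longrightarrow> (\<exists>m. c b = Null m)) \<and>
     (\<forall>w. white w \<longrightarrow> (\<exists>m r. c w = Timelike m r))"

text \<open>
  A circle is a point set in \<open>E2\<close>. The Euclidean metric of \<open>E2\<close> is the restriction of the standard
  metric of \<open>real^3\<close>.
\<close>

definition circle :: "real^3 \<Rightarrow> real \<Rightarrow> (real^3) set" where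
  "circle a \<rho> = sphere a \<rho> \<inter> E2"

definition is_circle :: "(real^3) set \<Rightarrow> bool" where
  "is_circle C \<longleftrightarrow> (\<exists>a \<rho>. a \<in> E2 \<and> \<rho> \<ge> 0 \<and> C = circle a \<rho>)"

text \<open>The center and the radius are determined by the circle as a point set.\<close>

definition touch :: "(real^3) set \<Rightarrow> (real^3) set \<Rightarrow> bool" where
  "touch C C' \<longleftrightarrow>
    (\<exists>a \<rho> a' \<rho>'. a \<in> E2 \<and> \<rho> \<ge> 0 \<and> C = circle a \<rho> \<and>
       a' \<in> E2 \<and> \<rho>' \<ge> 0 \<and> C' = circle a' \<rho>' \<and>
       (dist a a' = \<rho> + \<rho>' \<or> dist a a' = \<bar>\<rho> - \<rho>'\<bar>))"

definition circle_pattern :: "(vertex \<Rightarrow> (real^3) set) \<Rightarrow> (face \<Rightarrow> real^3) \<Rightarrow> bool" where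
  "circle_pattern p pF \<longleftrightarrow>
     (\<forall>v. is_circle (p v)) \<and> (\<forall>f. pF f \<in> E2) \<and>
     (\<forall>v f. incident v f \<longrightarrow> pF f \<in> p v)"

definition circle_packing :: "(vertex \<Rightarrow> (real^3) set) \<Rightarrow> (face \<Rightarrow> real^3) \<Rightarrow> bool" where
  "circle_packing p pF \<longleftrightarrow>
     circle_pattern p pF \<and>
     (\<forall>b b' f. black b \<longrightarrow> black b' \<longrightarrow> incident b f \<longrightarrow> incident b' f \<longrightarrow> touch (p b) (p b'))"

text \<open>
  The trace of a congruence on \<open>E2\<close>. An isotropic line meets \<open>E2\<close> in exactly one point, so
  \<open>the_elem\<close> is well-defined for it.
\<close>

lemma isotropic_line_Int_E2:
  assumes "oriented_isotropic_line l"
  shows "\<exists>x. fst l \<inter> E2 = {x}"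
proof -
  obtain q d where d: "d \<noteq> 0" "lorentz d d = 0" and L: "fst l = {q + t *\<^sub>R d | t. True}"
    using assms unfolding oriented_isotropic_line_def by blast
  have d3: "d $ 3 \<noteq> 0"
  proof
    assume "d $ 3 = 0"
    moreover from this d(2) have "d $ 1 = 0 \<and> d $ 2 = 0"
      by (simp add: lorentz_def sum_squares_eq_zero_iff)
    ultimately show False
      using d(1) by (simp add: vec_eq_iff forall_3)
  qed
  have *: "q $ 3 + t * d $ 3 = 0 \<longleftrightarrow> t = - q $ 3 / d $ 3" for t
    using d3 by (simp add: field_simps) (simp add: eq_neg_iff_add_eq_0 add.commute)
  have "fst l \<inter> E2 = {q + (- q $ 3 / d $ 3) *\<^sub>R d}"
  proof (rule set_eqI)
    fix x
    have "x \<in> fst l \<inter> E2 \<longleftrightarrow> (\<exists>t. x = q + t *\<^sub>R d \<and> q $ 3 + t * d $ 3 = 0)"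
      unfolding L E2_def by auto
    then show "x \<in> fst l \<inter> E2 \<longleftrightarrow> x \<in> {q + (- q $ 3 / d $ 3) *\<^sub>R d}"
      unfolding * by auto
  qed
  then show ?thesis ..
qed

definition sphere_trace :: "(vertex \<Rightarrow> lsphere) \<Rightarrow> vertex \<Rightarrow> (real^3) set" where
  "sphere_trace c v = sphere_points (c v) \<inter> E2"

definition line_trace :: "(face \<Rightarrow> oline) \<Rightarrow> face \<Rightarrow> real^3" where
  "line_trace cF f = the_elem (fst (cF f) \<inter> E2)"

end

theory Submission
  imports Defs
begin

text \<open>
  A Lorentz sphere with center \<open>m\<close> and radius \<open>r\<close> meets the Euclidean plane in the circle around the
  orthogonal projection of \<open>m\<close> with radius \<open>sqrt (r\<^sup>2 + m\<^sub>3\<^sup>2)\<close>, which is \<open>\<bar>m\<^sub>3\<bar>\<close> for a null-sphere. Two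
  null-spheres in contact with the same isotropic line have centers \<open>m\<close>, \<open>m'\<close> with isotropic
  difference, so the projections have distance \<open>\<bar>m\<^sub>3 - m'\<^sub>3\<bar>\<close>. This is \<open>\<bar>\<bar>m\<^sub>3\<bar> - \<bar>m'\<^sub>3\<bar>\<bar>\<close> or
  \<open>\<bar>m\<^sub>3\<bar> + \<bar>m'\<^sub>3\<bar>\<close>, according to the signs of \<open>m\<^sub>3\<close> and \<open>m'\<^sub>3\<close>.
\<close>

definition proj_E2 :: "real^3 \<Rightarrow> real^3" where
  "proj_E2 m = (\<chi> i. if i = 3 then 0 else m $ i)"

lemma proj_E2_nth [simp]:
  "proj_E2 m $ 1 = m $ 1" "proj_E2 m $ 2 = m $ 2" "proj_E2 m $ 3 = 0"
  by (simp_all add: proj_E2_def)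

lemma proj_E2_in_E2: "proj_E2 m \<in> E2"
  by (simp add: E2_def)

lemma proj_E2_ident: "x \<in> E2 \<Longrightarrow> proj_E2 x = x"
  by (simp add: E2_def vec_eq_iff forall_3)

text \<open>Projecting keeps the two positive squares of the form and drops the negative one, which
  is subtracted separately.\<close>

lemma lorentz_diff_eq_dist:
  "lorentz (x - y) (x - y) = (dist (proj_E2 x) (proj_E2 y))\<^sup>2 - (x $ 3 - y $ 3)\<^sup>2"
  unfolding dist_norm power2_norm_eq_inner
  by (simp add: lorentz_def inner_vec_def sum_3 power2_eq_square)

text \<open>Stated for the bare quadric with arbitrary \<open>r\<close>, so that
  \<open>r = 0\<close> covers the null-spheres.\<close>

lemma lorentz_quadric_Int_E2:
  "{x. lorentz (x - m) (x - m) = r\<^sup>2} \<inter> E2 = circle (proj_E2 m) (sqrt (r\<^sup>2 + (m $ 3)\<^sup>2))"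
proof -
  have "lorentz (x - m) (x - m) = r\<^sup>2 \<longleftrightarrow> dist (proj_E2 m) x = sqrt (r\<^sup>2 + (m $ 3)\<^sup>2)"
    if "x \<in> E2" for x
  proof -
    have "lorentz (x - m) (x - m) = (dist (proj_E2 m) x)\<^sup>2 - (m $ 3)\<^sup>2"
      using that by (simp add: lorentz_diff_eq_dist proj_E2_ident dist_commute)
        (simp add: E2_def)
    then have "lorentz (x - m) (x - m) = r\<^sup>2 \<longleftrightarrow> (dist (proj_E2 m) x)\<^sup>2 = r\<^sup>2 + (m $ 3)\<^sup>2"
      by auto
    also have "\<dots> \<longleftrightarrow> dist (proj_E2 m) x = sqrt (r\<^sup>2 + (m $ 3)\<^sup>2)"
      by (auto simp: real_sqrt_unique)
    finally show ?thesis .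
  qed
  then show ?thesis
    by (auto simp: circle_def)
qed

lemma timelike_Int_E2:
  "sphere_points (Timelike m r) \<inter> E2 = circle (proj_E2 m) (sqrt (r\<^sup>2 + (m $ 3)\<^sup>2))"
  by (simp add: lorentz_quadric_Int_E2)

lemma null_Int_E2: "sphere_points (Null m) \<inter> E2 = circle (proj_E2 m) \<bar>m $ 3\<bar>"
  using lorentz_quadric_Int_E2[of m 0] by simp

lemma is_circle_sphere_Int_E2: "is_circle (sphere_points s \<inter> E2)"
proof (cases s)
  case (Timelike m r)
  have "0 \<le> sqrt (r\<^sup>2 + (m $ 3)\<^sup>2)"
    by simp
  then show ?thesis
    unfolding is_circle_def Timelike timelike_Int_E2 using proj_E2_in_E2 by blast
next
  case (Null m)
  then show ?thesis
    unfolding is_circle_def Null null_Int_E2 using proj_E2_in_E2 abs_ge_zero by blast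
qed

lemma lorentz_scaleR: "lorentz (t *\<^sub>R x) (t *\<^sub>R x) = t\<^sup>2 * lorentz x x"
  by (simp add: lorentz_def power2_eq_square algebra_simps)

lemma isotropic_line_diff:
  assumes "oriented_isotropic_line l" "x \<in> fst l" "y \<in> fst l"
  shows "lorentz (x - y) (x - y) = 0"
proof -
  obtain q d where d: "lorentz d d = 0" and L: "fst l = {q + t *\<^sub>R d | t. True}"
    using assms(1) unfolding oriented_isotropic_line_def by blast
  obtain s t where "x = q + s *\<^sub>R d" "y = q + t *\<^sub>R d"
    using assms(2,3) L by auto
  then have "x - y = (s - t) *\<^sub>R d"
    by (simp add: algebra_simps)
  then show ?thesis
    using d by (simp add: lorentz_scaleR)
qed

text \<open>For a timelike sphere this is part of contact. For a null-sphere contact only puts the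
  center on the line, but all differences of points of an isotropic line are isotropic.\<close>

lemma in_contact_subset:
  assumes "oriented_isotropic_line l" "in_contact s l"
  shows "fst l \<subseteq> sphere_points s"
proof (cases s)
  case (Timelike m r)
  then show ?thesis
    using assms(2) by (cases l) simp
next
  case (Null m)
  then have "m \<in> fst l"
    using assms(2) by (cases l) simp
  then show ?thesis
    using isotropic_line_diff[OF assms(1)] by (auto simp: Null)
qed

lemma touch_null_Int_E2:
  assumes "lorentz (m - m') (m - m') = 0"
  shows "touch (sphere_points (Null m) \<inter> E2) (sphere_points (Null m') \<inter> E2)"
proof -
  have "(dist (proj_E2 m) (proj_E2 m'))\<^sup>2 = (m $ 3 - m' $ 3)\<^sup>2"
    using assms by (simp add: lorentz_diff_eq_dist)
  \<comment> \<open>Both sides are nonnegative, so equal squares suffice.\<close>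
  then have "dist (proj_E2 m) (proj_E2 m') = \<bar>m $ 3 - m' $ 3\<bar>"
    using power2_eq_iff_nonneg[of "dist (proj_E2 m) (proj_E2 m')" "\<bar>m $ 3 - m' $ 3\<bar>"] by simp
  then have "dist (proj_E2 m) (proj_E2 m') = \<bar>m $ 3\<bar> + \<bar>m' $ 3\<bar> \<or>
      dist (proj_E2 m) (proj_E2 m') = \<bar>\<bar>m $ 3\<bar> - \<bar>m' $ 3\<bar>\<bar>"
    by linarith
  then show ?thesis
    unfolding touch_def null_Int_E2 using proj_E2_in_E2 abs_ge_zero by blast
qed

text \<open>The intersection is a singleton, so \<open>the_elem\<close> yields a point of
  it.\<close>

lemma line_trace_in:
  assumes "oriented_isotropic_line (cF f)"
  shows "line_trace cF f \<in> fst (cF f) \<inter> E2"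
proof -
  obtain x where "fst (cF f) \<inter> E2 = {x}"
    using isotropic_line_Int_E2[OF assms] by blast
  then show ?thesis
    by (simp add: line_trace_def)
qed

theorem theorem2p9:
  fixes c :: "vertex \<Rightarrow> lsphere" and cF :: "face \<Rightarrow> oline"
  assumes "null_congruence c cF"
  shows "circle_packing (sphere_trace c) (line_trace cF)"
proof -
  have line: "oriented_isotropic_line (cF f)" for f
    using assms unfolding null_congruence_def contact_congruence_def by blast
  have contact: "in_contact (c v) (cF f)" if "incident v f" for v f
    using assms that unfolding null_congruence_def contact_congruence_def by blast
  have null: "\<exists>m. c b = Null m" if "black b" for b
    using assms that unfolding null_congruence_def by blast
  have trace: "line_trace cF f \<in> fst (cF f)" "line_trace cF f \<in> E2" for f
    using line_trace_in[of cF, OF line] by blast+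
  have "line_trace cF f \<in> sphere_trace c v" if "incident v f" for v f
    using in_contact_subset[OF line contact[OF that]] trace unfolding sphere_trace_def by blast
  then have "circle_pattern (sphere_trace c) (line_trace cF)"
    using trace(2) by (simp add: circle_pattern_def is_circle_sphere_Int_E2 sphere_trace_def)
  \<comment> \<open>The case \<open>b = b'\<close> is included: a circle touches itself by inner
    tangency, with distance and difference of radii both 0.\<close>
  moreover have "touch (sphere_trace c b) (sphere_trace c b')"
    if b: "black b" "black b'" and f: "incident b f" "incident b' f" for b b' f
  proof -
    obtain m m' where m: "c b = Null m" "c b' = Null m'"
      using null b by blast
    then have "m \<in> fst (cF f)" "m' \<in> fst (cF f)"
      using contact[OF f(1)] contact[OF f(2)] by (cases "cF f"; simp)+
    then show ?thesis
      unfolding sphere_trace_def m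
      by (intro touch_null_Int_E2 isotropic_line_diff[OF line])
  qed
  ultimately show ?thesis
    unfolding circle_packing_def by blast
qed

end
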